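(* For each integer partition $\mu$, $\mathrm{TAIL}(\mu)$ is the infinite sequence $(\mathrm{NU}_1^m(\mathrm{TI}(\mu)) : m\ge 0)$, and it consists of all Dyck classes $[z]$ such that $z$ is a cycled version of the binary Dyck vector $0B_{\mu}0^c$ for some $c\ge 0$. Letting $n=\mathrm{min}_{\Delta}(\mathrm{TI}(\mu))=\mu_1+\ell(\mu)+1$, the $\mathrm{min}_{\Delta}$-profile of $\mathrm{TAIL}(\mu)$ is $$n^1(n+1)^n(n+2)^{n+1}\cdots(n+c+1)^{n+c}\cdots$$ (exponents denote repetition counts). All objects in $\mathrm{TAIL}(\mu)$ have deficit $|\mu|$.
   Context: Vectors and classes. A quasi-Dyck vector (QDV) is an integer sequence $v=v_1v_2\cdots v_n$ with $v_1=0$ and $v_{i+1}\le v_i+1$ for all $i<n$; a Dyck vector is a QDV with all entries $\ge 0$; a binary Dyck vector (BDV) is a Dyck vector with entries in $\{0,1\}$. We use word notation; $i^c$ means $c$ copies of $i$; $W^{+}$, $W^-$ add, subtract $1$ from each entry of $W$. Dyck classes $[v]$ are the equivalence classes of the equivalence relation on QDVs generated by $v\sim 0v^+$. An integer partition $\lambda$ (with $\ell(\lambda)$ positive parts and $\lambda_i=0$ for $i>\ell(\lambda)$; the zero partition $\langle 0\rangle$ is allowed) is identified with the Dyck class consisting of all QDVs $\mathrm{QDV}_n(\lambda)=(0-\lambda_n,1-\lambda_{n-1},\ldots,n-1-\lambda_1)$, $n>\ell(\lambda)$; this is a bijection between partitions and Dyck classes. $\mathrm{min}_{\Delta}(\lambda)$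 is the least $n>\ell(\lambda)$ such that $\mathrm{QDV}_n(\lambda)$ has all entries nonnegative. Statistics. For a QDV $v$ of length $n$: $\mathrm{len}(v)=n$, $\mathrm{area}(v)=v_1+\cdots+v_n$; $\mathrm{dinv}(v)$ is the number of pairs of integers $i<j\le n$ with $v_i-v_j\in\{0,1\}$, where $v_k=k-1$ for all $k\le 0$; $\mathrm{defc}(v)=\binom{n}{2}-\mathrm{area}(v)-\mathrm{dinv}(v)$. The statistics dinv and defc (deficit) are constant on Dyck classes, hence defined for partitions. The map $\mathrm{NU}_1$. It is defined on partitions $\gamma$ with $\gamma_1\le \ell(\gamma)+2$ by $\mathrm{NU}_1(\gamma)=\langle \ell+1,\gamma_1-1,\ldots,\gamma_\ell-1\rangle$, $\ell=\ell(\gamma)$ (zero parts dropped); it is viewed as acting on Dyck classes. Tails. For nonzero $\mu=\langle r^{n_r}\cdots 2^{n_2}1^{n_1}\rangle$ with $n_r>0$ ($n_i$ is the number of parts equal to $i$), $B_\mu=01^{n_1}01^{n_2}\cdots 01^{n_r}$; $B_{\langle 0\rangle}$ is the empty word. $\mathrm{TI}(\mu)=[0B_\mu]$, and $\mathrm{TAIL}(\mu)$ is the sequence of Dyck classes reachable from $\mathrm{TI}(\mu)$ by applying $\mathrm{NU}_1$ zero or more times. For a BDV $v=0v_2\cdots v_n$, the cycled versions of $v$ are the QDVs $0v_{k+1}\cdots v_n v_2^-\cdots v_k^-$ for $1\le k\le n$. The $\mathrm{min}_{\Delta}$-profile of a sequence of partitions is obtained by replacing each term $\gamma$ by $\mathrm{min}_{\Delta}(\gamma)$.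 *)

theory Defs
  imports Complex_Main
begin

definition qdv :: "int list \<Rightarrow> bool" where
  "qdv v \<longleftrightarrow> v \<noteq> [] \<and> v ! 0 = 0 \<and> (\<forall>i. Suc i < length v \<longrightarrow> v ! Suc i \<le> v ! i + 1)"

text \<open>The generating step is restricted to quasi-Dyck vectors because \<open>0 # map (\<lambda>x. x + 1) v\<close>
  may be a quasi-Dyck vector when \<open>v\<close> is not.\<close>

definition dyck_step :: "int list \<Rightarrow> int list \<Rightarrow> bool" where
  "dyck_step v w \<longleftrightarrow> qdv v \<and> w = 0 # map (\<lambda>x. x + 1) v"

definition dyck_class :: "int list \<Rightarrow> int list set" where
  "dyck_class v = {w. equivclp dyck_step v w}"


text \<open>Integer partitions are weakly decreasing lists of positive integers; the zero partition is
  the empty list, and \<open>length\<close> is the number of positive parts.\<close>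

definition int_partition :: "nat list \<Rightarrow> bool" where
  "int_partition \<gamma> \<longleftrightarrow> sorted_wrt (\<ge>) \<gamma> \<and> 0 \<notin> set \<gamma>"

text \<open>Parts are indexed from 1.\<close>

definition part :: "nat list \<Rightarrow> nat \<Rightarrow> nat" where
  "part \<gamma> i = (if 1 \<le> i \<and> i \<le> length \<gamma> then \<gamma> ! (i - 1) else 0)"

definition QDV :: "nat \<Rightarrow> nat list \<Rightarrow> int list" where
  "QDV n \<gamma> = map (\<lambda>i. int i - int (part \<gamma> (n - i))) [0..<n]"

definition partition_class :: "nat list \<Rightarrow> int list set" where
  "partition_class \<gamma> = {QDV n \<gamma> | n. n > length \<gamma>}"

text \<open>\<open>partition_class\<close> is a bijection from partitions to Dyck classes; its inverse is what lets
  functions of partitions act on Dyck classes.\<close>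

definition class_partition :: "int list set \<Rightarrow> nat list" where
  "class_partition = the_inv_into (Collect int_partition) partition_class"

definition min_delta :: "nat list \<Rightarrow> nat" where
  "min_delta \<gamma> = (LEAST n. n > length \<gamma> \<and> (\<forall>x\<in>set (QDV n \<gamma>). 0 \<le> x))"

definition class_min_delta :: "int list set \<Rightarrow> nat" where
  "class_min_delta C = min_delta (class_partition C)"


definition area :: "int list \<Rightarrow> int" where
  "area v = sum_list v"

text \<open>The entry \<open>v\<^sub>k\<close>, indexed from 1 and extended to all integers \<open>k \<le> length v\<close>.\<close>

definition entry :: "int list \<Rightarrow> int \<Rightarrow> int" where
  "entry v k = (if k \<le> 0 then k - 1 else v ! nat (k - 1))"

text \<open>The set counted is finite: if \<open>i \<le> 0\<close> then \<open>entry v i = i - 1\<close>, so there is no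
  contribution from \<open>j \<le> 0\<close>, and for each \<open>j > 0\<close> only finitely many such \<open>i\<close> contribute.\<close>

definition dinv :: "int list \<Rightarrow> nat" where
  "dinv v = card {(i, j). i < j \<and> j \<le> int (length v) \<and> entry v i - entry v j \<in> {0, 1}}"

definition defc :: "int list \<Rightarrow> int" where
  "defc v = int (length v choose 2) - area v - int (dinv v)"


text \<open>Partial maps: the value is \<open>None\<close> outside the domain \<open>\<gamma>\<^sub>1 \<le> \<ell>(\<gamma>) + 2\<close>.\<close>

definition NU1 :: "nat list \<Rightarrow> nat list option" where
  "NU1 \<gamma> = (if part \<gamma> 1 \<le> length \<gamma> + 2
    then Some (filter (\<lambda>k. k > 0) ((length \<gamma> + 1) # map (\<lambda>k. k - 1) \<gamma>))
    else None)"

definition class_NU1 :: "int list set \<Rightarrow> int list set option" where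
  "class_NU1 C = map_option partition_class (NU1 (class_partition C))"


definition Bword :: "nat list \<Rightarrow> int list" where
  "Bword \<mu> = concat (map (\<lambda>i. 0 # replicate (count_list \<mu> i) 1) [1..<part \<mu> 1 + 1])"

definition TI :: "nat list \<Rightarrow> int list set" where
  "TI \<mu> = dyck_class (0 # Bword \<mu>)"

text \<open>\<open>TAIL \<mu> m\<close> is the result of applying \<open>NU1\<close> to \<open>TI \<mu>\<close> \<open>m\<close> times, and \<open>None\<close> if
  the iteration leaves the domain of \<open>NU1\<close> before that.\<close>

definition TAIL :: "nat list \<Rightarrow> nat \<Rightarrow> int list set option" where
  "TAIL \<mu> m = ((\<lambda>X. Option.bind X class_NU1) ^^ m) (Some (TI \<mu>))"

definition cycled_versions :: "int list \<Rightarrow> int list set" where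
  "cycled_versions v =
    {0 # drop k v @ map (\<lambda>x. x - 1) (drop 1 (take k v)) | k. 1 \<le> k \<and> k \<le> length v}"

text \<open>The initial segment of the claimed profile consisting of the block \<open>n\<^sup>1\<close> and the next
  \<open>c\<close> blocks.\<close>

definition profile_prefix :: "nat \<Rightarrow> nat \<Rightarrow> nat list" where
  "profile_prefix n c =
    replicate 1 n @ concat (map (\<lambda>i. replicate (n + i) (n + i + 1)) [0..<c])"

end

theory Submission
  imports Defs
begin

text \<open>Every Dyck class contains a vector \<open>0w\<close> with \<open>w\<close> empty or beginning with a nonpositive
  entry, and \<open>NU1\<close> sends it to the class of \<open>0w\<^sup>+0\<close>. Applied to a cycled version
  \<open>0 v\<^sub>k\<^sub>+\<^sub>1 \<dots> v\<^sub>n v\<^sub>2\<^sup>- \<dots> v\<^sub>k\<^sup>-\<close> of a binary Dyck vector, this moves \<open>v\<^sub>k\<^sub>+\<^sub>1\<close> to the right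
  end and lowers it; after a full turn the result is \<open>0 v\<^sub>2 \<dots> v\<^sub>n 0\<close>, so that the cycle starts
  again with one more trailing zero. The map \<open>NU1\<close> increases the size of a partition and its
  dinv by 1, hence preserves the deficit.\<close>

subsection \<open>Partitions and Dyck classes\<close>

text \<open>The \<open>successively\<close> form splits along \<open>#\<close>, \<open>@\<close> and
  \<open>map\<close>, which is how vectors are assembled below.\<close>

lemma qdv_iff:
  "qdv v \<longleftrightarrow> v \<noteq> [] \<and> hd v = 0 \<and> successively (\<lambda>x y. y \<le> x + 1) v"
  unfolding qdv_def successively_conv_nth by (auto simp: hd_conv_nth)

lemma dyck_class_eqI: "equivclp dyck_step v w \<Longrightarrow> dyck_class v = dyck_class w"
  unfolding dyck_class_def by (blast intro: equivclp_trans equivclp_sym)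

lemma dyck_class_step: "qdv v \<Longrightarrow> dyck_class (0 # map (\<lambda>x. x + 1) v) = dyck_class v"
  by (rule dyck_class_eqI[symmetric], rule r_into_equivclp) (simp add: dyck_step_def)

lemma qdv_step: "qdv v \<Longrightarrow> qdv (0 # map (\<lambda>x. x + 1) v)"
  by (cases v) (auto simp: qdv_iff successively_map successively_Cons hd_map add.commute)

lemma self_in_dyck_class: "v \<in> dyck_class v"
  by (simp add: dyck_class_def)

section \<open>Parts of a partition\<close>

lemma part_Cons: "part (x # xs) i = (if i = 0 then 0 else if i = 1 then x else part xs (i - 1))"
  unfolding part_def by (cases i) (auto simp: nth_Cons')

lemma part_eq_0_iff:
  assumes "int_partition \<gamma>"
  shows "part \<gamma> i = 0 \<longleftrightarrow> i = 0 \<or> length \<gamma> < i"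
proof -
  have "\<gamma> ! (i - 1) \<noteq> 0" if "1 \<le> i" "i \<le> length \<gamma>"
  proof -
    have "\<gamma> ! (i - 1) \<in> set \<gamma>" by (rule nth_mem) (use that in auto)
    then show ?thesis using assms by (metis int_partition_def)
  qed
  then show ?thesis by (auto simp: part_def)
qed

lemma part_mono:
  assumes "sorted_wrt (\<ge>) \<gamma>" "1 \<le> i" "i \<le> j"
  shows "part \<gamma> j \<le> part \<gamma> i"
  using assms sorted_wrt_nth_less[of "(\<ge>)" \<gamma> "i - 1" "j - 1"]
  by (cases "i = j") (auto simp: part_def)

text \<open>In a weakly decreasing list the zeros form a suffix, so removing them moves no positive
  part, and \<open>part\<close> returns 0 past the end.\<close>

lemma part_filter_positive:
  assumes "sorted_wrt (\<ge>) xs"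
  shows "part (filter (\<lambda>k. k > 0) xs) i = part xs i"
  using assms
proof (induction xs arbitrary: i)
  case (Cons x xs)
  show ?case
  proof (cases "x > 0")
    case True
    with Cons show ?thesis by (auto simp: part_Cons)
  next
    case False
    with Cons.prems have zero: "\<forall>y\<in>set (x # xs). y = 0" by auto
    then have "filter (\<lambda>k. k > 0) (x # xs) = []" by (auto simp: filter_empty_conv)
    moreover have "part (x # xs) i = 0"
      using zero nth_mem[of "i - 1" "x # xs"] unfolding part_def by auto
    ultimately show ?thesis by (simp only:) (simp add: part_def)
  qed
qed simp

lemma partition_eqI:
  assumes "int_partition \<gamma>" "int_partition \<delta>" "\<And>i. part \<gamma> i = part \<delta> i"
  shows "\<gamma> = \<delta>"
proof (rule nth_equalityI)
  show len: "length \<gamma> = length \<delta>"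
    using part_eq_0_iff[OF assms(1)] part_eq_0_iff[OF assms(2)] assms(3)
    by (metis le_neq_implies_less lessI less_irrefl nat.distinct(1) nat_le_linear not_less_eq
        not_less_less_Suc_eq)
  fix i assume "i < length \<gamma>"
  with assms(3)[of "Suc i"] len show "\<gamma> ! i = \<delta> ! i" by (simp add: part_def)
qed

section \<open>The vectors of a partition and their Dyck class\<close>

lemma length_QDV [simp]: "length (QDV n \<gamma>) = n"
  by (simp add: QDV_def)

lemma QDV_nth: "i < n \<Longrightarrow> QDV n \<gamma> ! i = int i - int (part \<gamma> (n - i))"
  by (simp add: QDV_def)

lemma QDV_Suc:
  assumes "n \<ge> length \<gamma>"
  shows "QDV (Suc n) \<gamma> = 0 # map (\<lambda>x. x + 1) (QDV n \<gamma>)"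
proof (rule nth_equalityI)
  fix i assume i: "i < length (QDV (Suc n) \<gamma>)"
  show "QDV (Suc n) \<gamma> ! i = (0 # map (\<lambda>x. x + 1) (QDV n \<gamma>)) ! i"
  proof (cases i)
    case 0
    with assms show ?thesis by (simp add: QDV_nth) (simp add: part_def)
  next
    case (Suc j)
    with i show ?thesis by (simp add: QDV_nth)
  qed
qed simp

lemma qdv_QDV:
  assumes "int_partition \<gamma>" "n > length \<gamma>"
  shows "qdv (QDV n \<gamma>)"
  unfolding qdv_def
proof (intro conjI allI impI)
  show "QDV n \<gamma> \<noteq> []" using assms by (metis length_QDV list.size(3) not_less_zero)
  show "QDV n \<gamma> ! 0 = 0" using assms by (simp add: QDV_nth part_def)
  fix i assume "Suc i < length (QDV n \<gamma>)"
  then show "QDV n \<gamma> ! Suc i \<le> QDV n \<gamma> ! i + 1"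
    using part_mono[of \<gamma> "n - Suc i" "n - i"] assms by (auto simp: QDV_nth int_partition_def)
qed

text \<open>Lengthening \<open>QDV m \<gamma>\<close> by one is exactly one
  \<open>dyck_step\<close>, so these vectors form a chain; the chain is also closed under both
  directions of the step.\<close>

lemma dyck_class_QDV:
  assumes "int_partition \<gamma>" "n > length \<gamma>"
  shows "dyck_class (QDV n \<gamma>) = partition_class \<gamma>"
proof
  have step: "dyck_class (QDV (Suc m) \<gamma>) = dyck_class (QDV m \<gamma>)" if "m > length \<gamma>" for m
    using dyck_class_step[OF qdv_QDV[OF assms(1) that]] QDV_Suc that by simp
  have base: "dyck_class (QDV m \<gamma>) = dyck_class (QDV (Suc (length \<gamma>)) \<gamma>)"
    if "m \<ge> Suc (length \<gamma>)" for m
    using that by (induction m rule: dec_induct) (auto simp: step)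
  show "partition_class \<gamma> \<subseteq> dyck_class (QDV n \<gamma>)"
  proof
    fix v assume "v \<in> partition_class \<gamma>"
    then obtain m where v: "v = QDV m \<gamma>" and m: "m > length \<gamma>" by (auto simp: partition_class_def)
    have "dyck_class v = dyck_class (QDV n \<gamma>)"
      unfolding v by (simp only: base[OF Suc_leI[OF m]] base[OF Suc_leI[OF assms(2)]])
    then show "v \<in> dyck_class (QDV n \<gamma>)" using self_in_dyck_class[of v] by simp
  qed
  show "dyck_class (QDV n \<gamma>) \<subseteq> partition_class \<gamma>"
  proof
    fix w assume "w \<in> dyck_class (QDV n \<gamma>)"
    then have "equivclp dyck_step (QDV n \<gamma>) w" by (simp add: dyck_class_def)
    then show "w \<in> partition_class \<gamma>"
    proof (induction rule: equivclp_induct)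
      case base
      show ?case using assms(2) by (auto simp: partition_class_def)
    next
      case (step u w)
      then obtain m where m: "u = QDV m \<gamma>" "m > length \<gamma>" by (auto simp: partition_class_def)
      from step(2) show ?case
      proof
        assume "dyck_step u w"
        then have "w = QDV (Suc m) \<gamma>" using m by (simp add: dyck_step_def QDV_Suc)
        then show ?case using m(2) less_SucI by (auto simp: partition_class_def)
      next
        assume "dyck_step w u"
        then have w: "qdv w" "u = 0 # map (\<lambda>x. x + 1) w" by (auto simp: dyck_step_def)
        \<comment> \<open>As \<open>w\<close> begins with 0, the second entry of \<open>u\<close> is
          1; in \<open>QDV m \<gamma>\<close> that entry is 1 minus part \<open>m - 1\<close>. Hence
          this part vanishes and the step can be undone inside the chain.\<close>
        then have "u ! 1 = 1" "length u \<ge> 2" by (cases w; simp add: qdv_def)+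
        with m have "part \<gamma> (m - 1) = 0" "m \<ge> 2" using QDV_nth[of 1 m \<gamma>] by auto
        then have m': "m - 1 > length \<gamma>" using part_eq_0_iff[OF assms(1)] by auto
        then have "u = 0 # map (\<lambda>x. x + 1) (QDV (m - 1) \<gamma>)"
          using QDV_Suc[of \<gamma> "m - 1"] m \<open>m \<ge> 2\<close> by simp
        with w have "w = QDV (m - 1) \<gamma>" by (simp add: inj_map_eq_map inj_def)
        with m' show ?case by (auto simp: partition_class_def)
      qed
    qed
  qed
qed

lemma inj_on_partition_class: "inj_on partition_class (Collect int_partition)"
proof (rule inj_onI, clarsimp)
  fix \<gamma> \<delta> assume p: "int_partition \<gamma>" "int_partition \<delta>"
    and eq: "partition_class \<gamma> = partition_class \<delta>"
  \<comment> \<open>A class has only one vector of each length, so a common length suffices; beyond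
    this \<open>n\<close> all parts of both partitions are 0.\<close>
  define n where "n = Suc (max (length \<gamma>) (length \<delta>))"
  have "QDV n \<gamma> \<in> partition_class \<gamma>" by (auto simp: partition_class_def n_def)
  with eq obtain m where m: "QDV n \<gamma> = QDV m \<delta>" by (auto simp: partition_class_def)
  then have [simp]: "m = n" by (metis length_QDV)
  show "\<gamma> = \<delta>"
  proof (rule partition_eqI[OF p])
    fix i
    show "part \<gamma> i = part \<delta> i"
    proof (cases "1 \<le> i \<and> i \<le> n")
      case True
      with m QDV_nth[of "n - i" n \<gamma>] QDV_nth[of "n - i" n \<delta>] show ?thesis by auto
    next
      case False
      then show ?thesis by (auto simp: part_def n_def)
    qed
  qed
qed

lemma class_partition_partition_class [simp]:
  "int_partition \<gamma> \<Longrightarrow> class_partition (partition_class \<gamma>) = \<gamma>"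
  unfolding class_partition_def using the_inv_into_f_f[OF inj_on_partition_class] by simp

lemma int_partition_filter: "sorted_wrt (\<ge>) xs \<Longrightarrow> int_partition (filter (\<lambda>k. k > 0) xs)"
  by (auto simp: int_partition_def intro: sorted_wrt_filter)

text \<open>The parts are the defects of \<open>v\<close> from the staircase 0, 1, 2, ..., read from
  the right. Slow growth of \<open>v\<close> makes them weakly decreasing, and the initial 0 makes
  the last one vanish.\<close>

lemma qdv_obtain_partition:
  assumes "qdv v"
  obtains \<gamma> where "int_partition \<gamma>" "length \<gamma> < length v" "QDV (length v) \<gamma> = v"
    "dyck_class v = partition_class \<gamma>"
proof -
  define n where "n = length v"
  have n: "n > 0" and v0: "v ! 0 = 0" and vs: "\<And>i. Suc i < n \<Longrightarrow> v ! Suc i \<le> v ! i + 1"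
    using assms by (auto simp: n_def qdv_def)
  have le: "b < n \<Longrightarrow> v ! b \<le> v ! a + int (b - a)" if "a \<le> b" for a b
    using that
  proof (induction b rule: dec_induct)
    case (step m)
    with vs[of m] show ?case by simp
  qed simp
  \<comment> \<open>The truncation by \<open>nat\<close> loses nothing: \<open>le\<close> from index
    0 gives \<open>v ! i \<le> i\<close>.\<close>
  define xs where "xs = map (\<lambda>i. nat (int (n - 1 - i) - v ! (n - 1 - i))) [0..<n]"
  have part_xs: "part xs i = nat (int (n - i) - v ! (n - i))" if "1 \<le> i" "i \<le> n" for i
    using that by (cases i) (auto simp: part_def xs_def)
  have "xs ! j \<le> xs ! i" if "i < j" "j < length xs" for i j
    using that le[of "n - 1 - j" "n - 1 - i"] by (force simp: xs_def intro!: nat_mono)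
  then have sorted: "sorted_wrt (\<ge>) xs" by (simp add: sorted_wrt_iff_nth_less)
  define \<gamma> where "\<gamma> = filter (\<lambda>k. k > 0) xs"
  have part: "part \<gamma> i = part xs i" for i unfolding \<gamma>_def by (rule part_filter_positive[OF sorted])
  have p: "int_partition \<gamma>" unfolding \<gamma>_def by (rule int_partition_filter[OF sorted])
  have len: "length \<gamma> < n"
    using part_eq_0_iff[OF p, of n] part[of n] part_xs[of n] n v0 by simp
  have v: "QDV n \<gamma> = v"
  proof (rule nth_equalityI)
    fix i assume "i < length (QDV n \<gamma>)"
    then have "i < n" by simp
    then show "QDV n \<gamma> ! i = v ! i"
      using le[of 0 i] v0 by (simp add: QDV_nth part part_xs)
  qed (simp add: n_def)
  have "dyck_class v = partition_class \<gamma>" using dyck_class_QDV[OF p len] v by simp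
  from p len v this show thesis unfolding n_def by (rule that)
qed

subsection \<open>The action of \<open>NU1\<close> on vectors\<close>

text \<open>The new largest part \<open>length \<gamma> + 1\<close> becomes the last entry 0, and
  lowering each old part while its index shifts by one raises its entry by 1. The domain condition
  keeps the list of parts sorted.\<close>

lemma NU1_QDV:
  assumes p: "int_partition \<gamma>" and w: "QDV (Suc (length \<gamma>)) \<gamma> = 0 # w"
    and dom: "part \<gamma> 1 \<le> length \<gamma> + 2"
  obtains \<gamma>' where "NU1 \<gamma> = Some \<gamma>'" "int_partition \<gamma>'" "length \<gamma>' < length \<gamma> + 2"
    "QDV (length \<gamma> + 2) \<gamma>' = 0 # map (\<lambda>x. x + 1) w @ [0]"
proof -
  define l where "l = length \<gamma>"
  define xs where "xs = (l + 1) # map (\<lambda>k. k - 1) \<gamma>"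
  define \<gamma>' where "\<gamma>' = filter (\<lambda>k. k > 0) xs"
  have srt: "sorted_wrt (\<ge>) \<gamma>" using p by (simp add: int_partition_def)
  have "k \<le> l + 2" if "k \<in> set \<gamma>" for k
  proof -
    from that obtain i where "i < length \<gamma>" "\<gamma> ! i = k" by (auto simp: in_set_conv_nth)
    with part_mono[OF srt, of 1 "Suc i"] dom show ?thesis by (simp add: part_def l_def)
  qed
  moreover have "sorted_wrt (\<ge>) (map (\<lambda>k. k - 1) \<gamma>)"
    unfolding sorted_wrt_map by (rule sorted_wrt_mono_rel[OF _ srt]) auto
  ultimately have sorted: "sorted_wrt (\<ge>) xs"
    unfolding xs_def by (auto simp: diff_le_mono le_diff_conv)
  have p': "int_partition \<gamma>'" unfolding \<gamma>'_def by (rule int_partition_filter[OF sorted])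
  have part_map: "part (map (\<lambda>k. k - 1) \<gamma>) i = part \<gamma> i - 1" for i
    by (cases i) (auto simp: part_def)
  have part': "part \<gamma>' i = (if i = 0 then 0 else if i = 1 then l + 1 else part \<gamma> (i - 1) - 1)" for i
    unfolding \<gamma>'_def part_filter_positive[OF sorted]
    unfolding xs_def part_Cons part_map by simp
  have lw: "length w = l" using arg_cong[OF w, of length] by (simp add: l_def)
  have w_nth: "w ! i = int (Suc i) - int (part \<gamma> (l - i))" if "i < l" for i
    using QDV_nth[of "Suc i" "Suc l" \<gamma>] w that by (simp add: l_def)
  have "QDV (l + 2) \<gamma>' = 0 # map (\<lambda>x. x + 1) w @ [0]"
  proof (rule nth_equalityI)
    fix i assume "i < length (QDV (l + 2) \<gamma>')"
    then consider "i = 0" | "i = Suc l" | j where "i = Suc j" "j < l"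
      by (cases i) (auto simp: less_Suc_eq)
    then show "QDV (l + 2) \<gamma>' ! i = (0 # map (\<lambda>x. x + 1) w @ [0]) ! i"
    proof cases
      case 1
      then show ?thesis by (simp add: QDV_nth part') (simp add: part_def l_def)
    next
      case 2
      then show ?thesis by (simp add: QDV_nth part' nth_append lw)
    next
      case 3
      \<comment> \<open>Positivity makes the truncated subtraction of 1 exact.\<close>
      then have "part \<gamma> (l - j) \<noteq> 0" using part_eq_0_iff[OF p] by (simp add: l_def)
      with 3 show ?thesis
        by (simp add: QDV_nth part' nth_append lw w_nth Suc_diff_le)
    qed
  qed (simp add: lw)
  moreover have "NU1 \<gamma> = Some \<gamma>'" using dom by (simp add: NU1_def \<gamma>'_def xs_def l_def)
  moreover have "length \<gamma>' \<le> length xs" unfolding \<gamma>'_def by (rule length_filter_le)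
  then have "length \<gamma>' < l + 2" by (simp add: xs_def l_def)
  ultimately show thesis using that p' by (simp add: l_def)
qed

text \<open>A nonpositive head of \<open>w\<close> says that \<open>0 # w\<close> is the shortest
  vector of its class, as \<open>NU1_QDV\<close> requires. The domain condition is read off the
  image: the rise to its final 0 is at most 1, so \<open>last w \<ge> -2\<close>.\<close>

lemma class_NU1_dyck_class:
  assumes q: "qdv (0 # w)" and h: "w = [] \<or> hd w \<le> 0"
    and q': "qdv (0 # map (\<lambda>x. x + 1) w @ [0])"
  shows "class_NU1 (dyck_class (0 # w)) = Some (dyck_class (0 # map (\<lambda>x. x + 1) w @ [0]))"
proof -
  obtain \<gamma> where g: "int_partition \<gamma>" "length \<gamma> < Suc (length w)"
    "QDV (Suc (length w)) \<gamma> = 0 # w" "dyck_class (0 # w) = partition_class \<gamma>"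
    using qdv_obtain_partition[OF q] by (metis length_Cons)
  have lw: "length w = length \<gamma>"
  proof (cases "w = []")
    case False
    then have "w ! 0 = 1 - int (part \<gamma> (length w))"
      using QDV_nth[of 1 "Suc (length w)" \<gamma>] g(3) by simp
    then have "part \<gamma> (length w) \<noteq> 0" using h False by (auto simp: hd_conv_nth)
    then show ?thesis using g(2) part_eq_0_iff[OF g(1)] by auto
  qed (use g in simp)
  have "part \<gamma> 1 \<le> length \<gamma> + 2"
  proof (cases "w = []")
    case False
    then have "last w \<ge> -2"
      using q' by (auto simp: qdv_iff successively_append_iff successively_Cons last_map)
    moreover have "last w = (0 # w) ! length w" using False by (simp add: last_conv_nth nth_Cons')
    ultimately show ?thesis
      using QDV_nth[of "length w" "Suc (length w)" \<gamma>] g(3) lw by simp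
  qed (use lw in \<open>simp add: part_def\<close>)
  moreover have "QDV (Suc (length \<gamma>)) \<gamma> = 0 # w" using g(3) lw by simp
  ultimately obtain \<gamma>' where g': "NU1 \<gamma> = Some \<gamma>'" "int_partition \<gamma>'" "length \<gamma>' < length \<gamma> + 2"
    "QDV (length \<gamma> + 2) \<gamma>' = 0 # map (\<lambda>x. x + 1) w @ [0]"
    using NU1_QDV[OF g(1)] by blast
  have "class_NU1 (dyck_class (0 # w)) = Some (partition_class \<gamma>')"
    using g g' by (simp add: class_NU1_def)
  also have "partition_class \<gamma>' = dyck_class (0 # map (\<lambda>x. x + 1) w @ [0])"
    using dyck_class_QDV[OF g'(2,3)] g'(4) by simp
  finally show ?thesis .
qed

text \<open>If a shorter nonnegative vector existed, the tail of \<open>v\<close> would be a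
  nonnegative vector raised by 1 and could contain no 0.\<close>

lemma class_min_delta_dyck_class:
  assumes q: "qdv v" and nonneg: "\<forall>x\<in>set v. 0 \<le> x" and zero: "tl v = [] \<or> 0 \<in> set (tl v)"
  shows "class_min_delta (dyck_class v) = length v"
proof -
  define n where "n = length v"
  obtain \<gamma> where g: "int_partition \<gamma>" "length \<gamma> < n" "QDV n \<gamma> = v" "dyck_class v = partition_class \<gamma>"
    using qdv_obtain_partition[OF q] unfolding n_def .
  \<comment> \<open>Lengthening preserves nonnegativity, so a shorter candidate can be taken to have
    length \<open>n - 1\<close>.\<close>
  have mono: "\<forall>x\<in>set (QDV k \<gamma>). 0 \<le> x"
    if "m > length \<gamma>" "\<forall>x\<in>set (QDV m \<gamma>). 0 \<le> x" "m \<le> k" for m k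
    using that(3)
  proof (induction k rule: dec_induct)
    case (step k)
    then have "QDV (Suc k) \<gamma> = 0 # map (\<lambda>x. x + 1) (QDV k \<gamma>)" using that(1) by (intro QDV_Suc) simp
    with step show ?case by auto
  qed (use that in blast)
  have "min_delta \<gamma> = n" unfolding min_delta_def
  proof (rule Least_equality)
    fix m assume m: "length \<gamma> < m \<and> (\<forall>x\<in>set (QDV m \<gamma>). 0 \<le> x)"
    show "n \<le> m"
    proof (rule ccontr)
      assume "\<not> n \<le> m"
      with m have 1: "\<forall>x\<in>set (QDV (n - 1) \<gamma>). 0 \<le> x" using mono[of m "n - 1"] by auto
      have "v = 0 # map (\<lambda>x. x + 1) (QDV (n - 1) \<gamma>)"
        using QDV_Suc[of \<gamma> "n - 1"] g \<open>\<not> n \<le> m\<close> m by (cases n) auto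
      then have tl: "tl v = map (\<lambda>x. x + 1) (QDV (n - 1) \<gamma>)" by simp
      with zero have "tl v = []" using 1 by force
      with tl have "n - 1 = 0" by (metis length_QDV length_map list.size(3))
      with m \<open>\<not> n \<le> m\<close> show False by simp
    qed
  qed (use g nonneg in auto)
  then show ?thesis using g by (simp add: class_min_delta_def n_def)
qed

subsection \<open>The deficit\<close>

lemma entry_snoc: "k \<le> int (length v) \<Longrightarrow> entry (v @ [x]) k = entry v k"
  by (auto simp: entry_def nth_append)

lemma entry_snoc_last: "entry (v @ [x]) (int (length v) + 1) = x"
  by (simp add: entry_def)

text \<open>The left partners that an entry \<open>x\<close> appended to \<open>v\<close> would
  acquire, including those at nonpositive indices.\<close>

definition dinv_left :: "int list \<Rightarrow> int \<Rightarrow> int set" where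
  "dinv_left v x = {i. i \<le> int (length v) \<and> entry v i - x \<in> {0, 1}}"

definition dinv_pairs :: "int list \<Rightarrow> (int \<times> int) set" where
  "dinv_pairs v = {(i, j). i < j \<and> j \<le> int (length v) \<and> entry v i - entry v j \<in> {0, 1}}"

lemma dinv_eq_card: "dinv v = card (dinv_pairs v)"
  by (simp only: dinv_def dinv_pairs_def)

lemma dinv_left_snoc:
  "dinv_left (v @ [y]) x =
     dinv_left v x \<union> (if y = x \<or> y = x + 1 then {int (length v) + 1} else {})"
proof -
  have "i \<le> int (length (v @ [y])) \<longleftrightarrow> i \<le> int (length v) \<or> i = int (length v) + 1" for i by auto
  moreover have "y - x \<in> {0, 1} \<longleftrightarrow> y = x \<or> y = x + 1" by auto
  ultimately show ?thesis
    unfolding dinv_left_def by (auto simp: entry_snoc entry_snoc_last)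
qed

lemma dinv_left_Nil: "dinv_left [] x = {x + 1, x + 2} \<inter> {..0}"
  by (auto simp: dinv_left_def entry_def)

lemma finite_dinv_left: "finite (dinv_left v x)"
  by (induction v rule: rev_induct) (auto simp: dinv_left_snoc dinv_left_Nil)

text \<open>The number of entries \<open>v\<^sub>k\<close> with \<open>k \<le> 0\<close> that lie in \<open>{x, x + 1}\<close>.\<close>

definition neg_count :: "int \<Rightarrow> nat" where
  "neg_count x = (if x \<le> -2 then 2 else if x = -1 then 1 else 0)"

text \<open>The nonpositive indices carry each negative integer exactly once and contribute
  \<open>neg_count x\<close>; the rest are entries of \<open>v\<close> itself.\<close>

lemma card_dinv_left:
  "card (dinv_left v x) = neg_count x + length (filter (\<lambda>y. y = x \<or> y = x + 1) v)"
proof (induction v rule: rev_induct)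
  case Nil
  have "dinv_left [] x = (if x \<le> -2 then {x + 1, x + 2} else if x = -1 then {0} else {})"
    by (auto simp: dinv_left_Nil)
  then show ?case by (simp add: neg_count_def)
next
  case (snoc y v)
  have "int (length v) + 1 \<notin> dinv_left v x" by (simp add: dinv_left_def)
  with snoc show ?case by (simp add: dinv_left_snoc finite_dinv_left)
qed

lemma dinv_pairs_snoc:
  "dinv_pairs (v @ [x]) = dinv_pairs v \<union> (\<lambda>i. (i, int (length v) + 1)) ` dinv_left v x"
proof -
  have "j \<le> int (length (v @ [x])) \<longleftrightarrow> j \<le> int (length v) \<or> j = int (length v) + 1" for j by auto
  then show ?thesis
    unfolding dinv_left_def dinv_pairs_def by (auto simp: entry_snoc entry_snoc_last)
qed

lemma dinv_pairs_Nil: "dinv_pairs [] = {}"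
  by (auto simp: dinv_pairs_def entry_def)

lemma finite_dinv_pairs: "finite (dinv_pairs v)"
  by (induction v rule: rev_induct) (auto simp: dinv_pairs_snoc dinv_pairs_Nil finite_dinv_left)

lemma dinv_Nil: "dinv [] = 0"
  by (simp add: dinv_eq_card dinv_pairs_Nil)

text \<open>The padding lies to the left, so old pairs persist and every new pair ends at the
  appended entry.\<close>

lemma dinv_snoc:
  "dinv (v @ [x]) = dinv v + neg_count x + length (filter (\<lambda>y. y = x \<or> y = x + 1) v)"
proof -
  have "dinv (v @ [x]) = card (dinv_pairs v) + card ((\<lambda>i. (i, int (length v) + 1)) ` dinv_left v x)"
    unfolding dinv_eq_card dinv_pairs_snoc
  proof (rule card_Un_disjoint)
    show "dinv_pairs v \<inter> (\<lambda>i. (i, int (length v) + 1)) ` dinv_left v x = {}"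
      by (auto simp: dinv_pairs_def)
  qed (auto simp: finite_dinv_pairs finite_dinv_left)
  also have "card ((\<lambda>i. (i, int (length v) + 1)) ` dinv_left v x) = card (dinv_left v x)"
    by (rule card_image) (simp add: inj_on_def)
  finally show ?thesis by (simp add: card_dinv_left dinv_eq_card)
qed

lemma choose_two_Suc: "Suc n choose 2 = (n choose 2) + n"
  by (simp add: numeral_2_eq_2)

lemma defc_snoc:
  "defc (v @ [x]) = defc v + int (length v) - x - int (neg_count x)
     - int (length (filter (\<lambda>y. y = x \<or> y = x + 1) v))"
  by (simp add: defc_def dinv_snoc choose_two_Suc area_def)

text \<open>The inserted 0 has no partner in the padding, and its partners to the right are the
  entries -1 and 0.\<close>

lemma dinv_Cons:
  "dinv (0 # w) = dinv w + length (filter (\<lambda>y. y = -1 \<or> y = 0) w)"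
proof (induction w rule: rev_induct)
  case Nil
  show ?case using dinv_snoc[of "[]" 0] by (simp add: dinv_Nil neg_count_def)
next
  case (snoc x w)
  then show ?case using dinv_snoc[of "0 # w" x] by (auto simp: dinv_snoc)
qed

text \<open>Raising the padding together with \<open>v\<close> turns its final -1 into the prefixed
  0, so all differences survive.\<close>

lemma dinv_step: "dinv (0 # map (\<lambda>x. x + 1) v) = dinv v"
proof (induction v rule: rev_induct)
  case Nil
  show ?case by (simp add: dinv_Cons dinv_Nil)
next
  case (snoc x v)
  have f: "length (filter (\<lambda>y. y = x + 1 \<or> y = x + 1 + 1) (map (\<lambda>x. x + 1) v)) =
    length (filter (\<lambda>y. y = x \<or> y = x + 1) v)"
    by (induction v) auto
  \<comment> \<open>The prefixed 0 replaces the partner that the raised entry may lose in the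
    padding.\<close>
  have n: "neg_count (x + 1) + length (filter (\<lambda>y. y = x + 1 \<or> y = x + 1 + 1) [0]) = neg_count x"
    by (auto simp: neg_count_def)
  have "dinv (0 # map (\<lambda>x. x + 1) (v @ [x])) = dinv ((0 # map (\<lambda>x. x + 1) v) @ [x + 1])"
    by simp
  also have "\<dots> = dinv (v @ [x])"
    unfolding dinv_snoc snoc n[symmetric] f[symmetric] by simp
  finally show ?case .
qed

lemma area_map_Suc: "area (map (\<lambda>x. x + 1) v) = area v + int (length v)"
  by (induction v) (auto simp: area_def)

lemma defc_step: "defc (0 # map (\<lambda>x. x + 1) v) = defc v"
  using area_map_Suc[of v] by (simp add: defc_def dinv_step choose_two_Suc area_def)

text \<open>The final 0 pairs with the first 0 and with the raised entries 0 and 1. The latter match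
  the pairs that \<open>0 # w\<close> has with its own first 0, so dinv grows by 1; area grows by
  \<open>length w\<close>, and the binomial by their sum.\<close>

lemma defc_NU1: "defc (0 # map (\<lambda>x. x + 1) w @ [0]) = defc (0 # w)"
proof -
  have "filter (\<lambda>y. y = 0 \<or> y = 1) (map (\<lambda>x. x + 1) w) =
    map (\<lambda>x. x + 1) (filter (\<lambda>y. y = -1 \<or> y = 0) w)"
    by (auto simp: filter_map o_def intro!: arg_cong[where f = "map _"] filter_cong)
  then have "dinv (0 # map (\<lambda>x. x + 1) w @ [0]) = Suc (dinv (0 # w))"
    using dinv_snoc[of "0 # map (\<lambda>x. x + 1) w" 0] dinv_step[of w]
    by (simp add: dinv_Cons[of w] neg_count_def)
  then show ?thesis
    using area_map_Suc[of w] by (simp add: defc_def choose_two_Suc area_def)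
qed

lemma defc_dyck_class: "w \<in> dyck_class v \<Longrightarrow> defc w = defc v"
  unfolding dyck_class_def mem_Collect_eq
  by (induction rule: equivclp_induct) (auto simp: dyck_step_def defc_step)

text \<open>A 1 at the right end pairs with precisely the ones before it, so it adds the number of
  zeros minus its own area 1.\<close>

lemma defc_append_ones:
  assumes "set v \<subseteq> {0, 1}"
  shows "defc (v @ replicate k 1) = defc v + int k * (int (count_list v 0) - 1)"
proof (induction k)
  case (Suc k)
  have fc: "int (length (filter (\<lambda>y. y = 1 \<or> y = 2) v)) = int (length v) - int (count_list v 0)"
    using assms by (induction v) auto
  have snoc: "v @ replicate (Suc k) 1 = (v @ replicate k 1) @ [1]"
    by (simp add: replicate_append_same)
  show ?case unfolding snoc defc_snoc using fc Suc by (simp add: neg_count_def algebra_simps)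
qed simp

text \<open>The appended 0 pairs with every entry of \<open>v\<close>, which cancels the growth of
  the binomial.\<close>

lemma defc_append_zero:
  assumes "set v \<subseteq> {0, 1}"
  shows "defc (v @ [0]) = defc v"
proof -
  have "filter (\<lambda>y. y = 0 \<or> y = 1) v = v" using assms by (auto simp: filter_id_conv)
  then show ?thesis by (simp add: defc_snoc neg_count_def)
qed

subsection \<open>The word \<open>B\<^sub>\<mu>\<close>\<close>

lemma set_Bword: "set (Bword \<mu>) \<subseteq> {0, 1}"
  by (auto simp: Bword_def)

lemma hd_Bword: "Bword \<mu> = [] \<or> hd (Bword \<mu>) = 0"
  by (cases "part \<mu> 1") (auto simp: Bword_def upt_rec simp del: upt_Suc)

lemma set_subset_part:
  assumes "int_partition \<mu>"
  shows "set \<mu> \<subseteq> {1..<part \<mu> 1 + 1}"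
proof
  fix k assume k: "k \<in> set \<mu>"
  then obtain i where i: "i < length \<mu>" "\<mu> ! i = k" by (auto simp: in_set_conv_nth)
  with assms part_mono[of \<mu> 1 "Suc i"] have "k \<le> part \<mu> 1"
    by (simp add: part_def int_partition_def)
  moreover have "k \<noteq> 0" using assms k by (metis int_partition_def)
  ultimately show "k \<in> {1..<part \<mu> 1 + 1}" by simp
qed

text \<open>There is one 0 for each value up to the largest part and one 1 for each part.\<close>

lemma length_Bword:
  assumes "int_partition \<mu>"
  shows "length (Bword \<mu>) = part \<mu> 1 + length \<mu>"
proof -
  have "length (Bword \<mu>) = (\<Sum>i\<leftarrow>[1..<part \<mu> 1 + 1]. 1 + count_list \<mu> i)"
    by (simp add: Bword_def length_concat o_def)
  also have "\<dots> = (\<Sum>i\<in>{1..<part \<mu> 1 + 1}. 1 + count_list \<mu> i)"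
    by (simp only: sum_set_upt_conv_sum_list_nat[symmetric] set_upt)
  also have "\<dots> = part \<mu> 1 + length \<mu>"
    using sum_count_set[OF set_subset_part[OF assms]] unfolding sum.distrib by simp
  finally show ?thesis .
qed

text \<open>Each 1 coming from a part \<open>i\<close> is preceded by \<open>i + 1\<close> zeros,
  the initial one included, and so contributes \<open>i\<close>.\<close>

lemma defc_Bword:
  assumes "int_partition \<mu>"
  shows "defc (0 # Bword \<mu>) = int (sum_list \<mu>)"
proof -
  \<comment> \<open>\<open>B r\<close> is the word cut off after the block of parts equal to
    \<open>r\<close>, which allows induction block by block.\<close>
  define B :: "nat \<Rightarrow> int list"
    where "B r = 0 # concat (map (\<lambda>i. 0 # replicate (count_list \<mu> i) 1) [1..<r + 1])" for r
  have B_Suc: "B (Suc r) = (B r @ [0]) @ replicate (count_list \<mu> (r + 1)) 1" for r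
    by (simp add: B_def)
  have B_set: "set (B r) \<subseteq> {0, 1}" for r by (auto simp: B_def)
  have B_count: "count_list (B r) 0 = r + 1" for r
  proof (induction r)
    case (Suc r)
    have "count_list (replicate k (1::int)) 0 = 0" for k by (induction k) auto
    with Suc show ?case by (simp add: B_Suc)
  qed (simp add: B_def)
  have "defc (B r) = int (\<Sum>i\<in>{1..<r + 1}. count_list \<mu> i * i)" for r
  proof (induction r)
    case 0
    show ?case using defc_snoc[of "[]" 0]
      by (simp add: B_def neg_count_def) (simp add: defc_def area_def dinv_Nil)
  next
    case (Suc r)
    have "defc (B (Suc r)) = defc (B r) + int (count_list \<mu> (r + 1)) * int (r + 1)"
      unfolding B_Suc using B_set[of r]
      by (subst defc_append_ones) (auto simp: B_count defc_append_zero)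
    with Suc show ?case by (simp add: algebra_simps)
  qed
  from this[of "part \<mu> 1"] show ?thesis
    using sum_list_map_eq_sum_count2[OF set_subset_part[OF assms], of id]
    by (simp add: B_def Bword_def)
qed

subsection \<open>Cycled versions of binary vectors\<close>

text \<open>\<open>b\<close> omits the leading 0, and \<open>j\<close> counts the letters already
  moved to the right end: this is the cycled version of \<open>0 # b\<close> with
  \<open>k = j + 1\<close>.\<close>

definition cyc :: "int list \<Rightarrow> nat \<Rightarrow> int list" where
  "cyc b j = 0 # drop j b @ map (\<lambda>x. x - 1) (take j b)"

lemma cycled_versions_eq: "cycled_versions (0 # b) = cyc b ` {..length b}"
proof -
  have "cyc b j = 0 # drop (Suc j) (0 # b) @ map (\<lambda>x. x - 1) (drop 1 (take (Suc j) (0 # b)))" for j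
    by (simp add: cyc_def)
  moreover have S: "{1..length (0 # b)} = Suc ` {..length b}"
    by (simp add: image_Suc_atMost)
  ultimately have "cyc b ` {..length b} =
    (\<lambda>k. 0 # drop k (0 # b) @ map (\<lambda>x. x - 1) (drop 1 (take k (0 # b)))) ` {1..length (0 # b)}"
    unfolding S image_image by (intro image_cong refl)
  then show ?thesis by (auto simp: cycled_versions_def)
qed

lemma successivelyI:
  assumes "set xs \<subseteq> A" "\<And>x y. x \<in> A \<Longrightarrow> y \<in> A \<Longrightarrow> P x y"
  shows "successively P xs"
  using assms by (auto simp: successively_conv_nth subset_iff)

text \<open>Each half uses two consecutive values only, and at the seam an entry at least 0 is
  followed by one at most 0.\<close>

lemma qdv_cyc:
  assumes "set b \<subseteq> {0, 1}"
  shows "qdv (cyc b j)"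
proof -
  have d: "set (drop j b) \<subseteq> {0, 1}" and t: "set (take j b) \<subseteq> {0, 1}"
    using assms set_drop_subset[of j b] set_take_subset[of j b] by auto
  have 1: "successively (\<lambda>x y. y \<le> x + 1) (0 # drop j b)"
    by (rule successivelyI[of _ "{0, 1}"]) (use d in auto)
  have 2: "successively (\<lambda>x y. y \<le> x + 1) (map (\<lambda>x. x - 1) (take j b))"
    by (rule successivelyI[of _ "{-1, 0}"]) (use t in auto)
  have 3: "last (0 # drop j b) \<ge> 0"
    using d last_in_set[of "0 # drop j b"] by auto
  have 4: "hd (map (\<lambda>x. x - 1) (take j b)) \<le> last (0 # drop j b) + 1" if "take j b \<noteq> []"
    using t hd_in_set[OF that] 3 that by (auto simp: hd_map simp del: last.simps)
  have "successively (\<lambda>x y. y \<le> x + 1) ((0 # drop j b) @ map (\<lambda>x. x - 1) (take j b))"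
    unfolding successively_append_iff using 1 2 4 by blast
  then show ?thesis by (simp add: qdv_iff cyc_def)
qed

lemma class_NU1_cyc:
  assumes b: "set b \<subseteq> {0, 1}" and j: "j < length b"
  shows "class_NU1 (dyck_class (cyc b j)) = Some (dyck_class (cyc b (Suc j)))"
proof -
  define A where "A = drop (Suc j) b @ map (\<lambda>x. x - 1) (take j b)"
  have c: "cyc b j = 0 # b ! j # A" using j by (simp add: cyc_def A_def Cons_nth_drop_Suc[symmetric])
  have c': "cyc b (Suc j) = 0 # A @ [b ! j - 1]"
    using j by (simp add: cyc_def A_def take_Suc_conv_app_nth)
  note q = qdv_cyc[OF b, of j] and q' = qdv_cyc[OF b, of "Suc j"]
  from b j have "b ! j = 0 \<or> b ! j = 1" using nth_mem[OF j] by blast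
  then show ?thesis
  proof
    \<comment> \<open>Here \<open>cyc b j\<close> is the shortest vector of its class, and its image
      is one \<open>dyck_step\<close> above \<open>cyc b (Suc j)\<close>.\<close>
    assume 0: "b ! j = 0"
    have *: "0 # map (\<lambda>x. x + 1) (0 # A) @ [0] = 0 # map (\<lambda>x. x + 1) (cyc b (Suc j))"
      using 0 by (simp add: c')
    have "class_NU1 (dyck_class (0 # 0 # A)) = Some (dyck_class (0 # map (\<lambda>x. x + 1) (0 # A) @ [0]))"
      by (rule class_NU1_dyck_class) (use q 0 c * qdv_step[OF q'] in auto)
    then show ?thesis unfolding * dyck_class_step[OF q'] using 0 c by simp
  next
    \<comment> \<open>Here \<open>cyc b j\<close> is itself the step of the shorter vector
      \<open>0 # w\<close>, whose image is \<open>cyc b (Suc j)\<close> on the nose.\<close>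
    assume 1: "b ! j = 1"
    define w where "w = map (\<lambda>x. x - 1) A"
    have A: "A = map (\<lambda>x. x + 1) w" by (simp add: w_def o_def)
    have cs: "cyc b j = 0 # map (\<lambda>x. x + 1) (0 # w)" using 1 by (simp add: c A)
    have qw: "qdv (0 # w)"
      using q unfolding cs qdv_iff
      by (cases "w = []") (simp_all add: successively_Cons successively_map hd_map add.commute)
    have "set A \<subseteq> {-1, 0, 1}"
      using b set_drop_subset[of "Suc j" b] set_take_subset[of j b] by (auto simp: A_def)
    then have "w = [] \<or> hd w \<le> 0" by (cases A) (auto simp: w_def)
    then have "class_NU1 (dyck_class (0 # w)) = Some (dyck_class (0 # map (\<lambda>x. x + 1) w @ [0]))"
      by (rule class_NU1_dyck_class[OF qw]) (use q' 1 in \<open>simp add: c' A\<close>)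
    then show ?thesis using dyck_class_step[OF qw] 1 by (simp add: cs c' A)
  qed
qed

text \<open>All letters have been lowered once; the map raises them back to \<open>b\<close> and
  appends a 0.\<close>

lemma class_NU1_cyc_last:
  assumes b: "set b \<subseteq> {0, 1}"
  shows "class_NU1 (dyck_class (cyc b (length b))) = Some (dyck_class (cyc (b @ [0]) 0))"
proof -
  define w where "w = map (\<lambda>x. x - 1) b"
  have 1: "cyc b (length b) = 0 # w" by (simp add: cyc_def w_def)
  have 2: "cyc (b @ [0]) 0 = 0 # map (\<lambda>x. x + 1) w @ [0]" by (simp add: cyc_def w_def o_def)
  have "w = [] \<or> hd w \<le> 0" using b by (cases b) (auto simp: w_def)
  then show ?thesis
    unfolding 1 2 using qdv_cyc[OF b, of "length b"] qdv_cyc[of "b @ [0]" 0] b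
    by (intro class_NU1_dyck_class) (auto simp: 1 2[symmetric])
qed

text \<open>For \<open>j = 0\<close> the vector is already nonnegative. Otherwise the first letter 0
  of \<open>b\<close> has become -1, and one further step is needed to raise it to 0.\<close>

lemma class_min_delta_cyc:
  assumes b: "set b \<subseteq> {0, 1}" and h: "b = [] \<or> hd b = 0" and j: "j \<le> length b"
  shows "class_min_delta (dyck_class (cyc b j)) = length b + (if j = 0 then 1 else 2)"
proof (cases "j = 0")
  case True
  have "b = [] \<or> 0 \<in> set b" using h by (metis hd_in_set)
  then have "class_min_delta (dyck_class (cyc b 0)) = length (cyc b 0)"
    by (intro class_min_delta_dyck_class[OF qdv_cyc[OF b]]) (use b in \<open>auto simp: cyc_def\<close>)
  with True show ?thesis by (simp add: cyc_def)
next
  case False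
  note q = qdv_cyc[OF b, of j]
  obtain b' where b': "b = 0 # b'" using False j h by (cases b) auto
  have "class_min_delta (dyck_class (0 # map (\<lambda>x. x + 1) (cyc b j))) = Suc (length (cyc b j))"
  proof (subst class_min_delta_dyck_class[OF qdv_step[OF q]])
    have "x \<ge> 0" if "x \<in> set (take j b) \<or> x \<in> set (drop j b)" for x
      using that b by (auto dest: in_set_takeD in_set_dropD)
    then show "\<forall>x\<in>set (0 # map (\<lambda>x. x + 1) (cyc b j)). 0 \<le> x"
      by (fastforce simp: cyc_def)
    have "0 \<in> set (take j b)" using False by (cases j) (auto simp: b')
    then have "0 \<in> set (map (\<lambda>x. x + 1) (cyc b j))" by (force simp: cyc_def)
    then show "tl (0 # map (\<lambda>x. x + 1) (cyc b j)) = [] \<or>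
        0 \<in> set (tl (0 # map (\<lambda>x. x + 1) (cyc b j)))" by simp
  qed simp
  moreover have "length (cyc b j) = Suc (length b)" using j by (simp add: cyc_def)
  ultimately show ?thesis using False by (simp add: dyck_class_step[OF q])
qed

text \<open>A representative \<open>u\<close> is carried along because \<open>defc\<close> is
  defined on vectors; the invariance itself is \<open>defc_NU1\<close> on the shortest
  representative.\<close>

lemma class_NU1_defc:
  assumes "qdv v" "class_NU1 (dyck_class v) = Some D"
  obtains u where "qdv u" "D = dyck_class u" "defc u = defc v"
proof -
  obtain \<gamma> where g: "int_partition \<gamma>" "dyck_class v = partition_class \<gamma>"
    using qdv_obtain_partition[OF assms(1)] by metis
  have dom: "part \<gamma> 1 \<le> length \<gamma> + 2"
    using assms(2) g by (auto simp: class_NU1_def NU1_def split: if_splits)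
  obtain w where w: "QDV (Suc (length \<gamma>)) \<gamma> = 0 # w"
    using qdv_QDV[OF g(1), of "Suc (length \<gamma>)"] by (cases "QDV (Suc (length \<gamma>)) \<gamma>") (auto simp: qdv_iff)
  obtain \<gamma>' where g': "NU1 \<gamma> = Some \<gamma>'" "int_partition \<gamma>'" "length \<gamma>' < length \<gamma> + 2"
    "QDV (length \<gamma> + 2) \<gamma>' = 0 # map (\<lambda>x. x + 1) w @ [0]"
    using NU1_QDV[OF g(1) w dom] .
  have "0 # w \<in> dyck_class v" using dyck_class_QDV[OF g(1), of "Suc (length \<gamma>)"] w g(2)
    by (metis lessI self_in_dyck_class)
  then have "defc (0 # w) = defc v" by (rule defc_dyck_class)
  moreover have "D = partition_class \<gamma>'" using assms(2) g g' by (simp add: class_NU1_def)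
  ultimately show thesis
    using that[of "0 # map (\<lambda>x. x + 1) w @ [0]"] g'(4) dyck_class_QDV[OF g'(2,3)] qdv_QDV[OF g'(2,3)]
      defc_NU1[of w] by simp
qed

subsection \<open>The tail\<close>

lemma TAIL_Suc: "TAIL \<mu> (Suc m) = Option.bind (TAIL \<mu> m) class_NU1"
  by (simp add: TAIL_def)

lemma TI_eq_cyc: "TI \<mu> = dyck_class (cyc (Bword \<mu>) 0)"
  by (simp add: TI_def cyc_def)

lemma TAIL_defc:
  assumes "TAIL \<mu> m = Some C"
  obtains u where "qdv u" "C = dyck_class u" "defc u = defc (0 # Bword \<mu>)"
proof -
  have "\<exists>u. qdv u \<and> C = dyck_class u \<and> defc u = defc (0 # Bword \<mu>)"
    using assms
  proof (induction m arbitrary: C)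
    case 0
    then show ?case using qdv_cyc[OF set_Bword, of \<mu> 0] by (auto simp: TAIL_def TI_def cyc_def)
  next
    case (Suc m)
    then obtain C' where "TAIL \<mu> m = Some C'" "class_NU1 C' = Some C"
      by (auto simp: TAIL_Suc bind_eq_Some_conv)
    with Suc.IH class_NU1_defc show ?case by metis
  qed
  with that show thesis by blast
qed

text \<open>The position in the tail at which the vectors with \<open>c\<close> additional zeros begin, where the
  first vector has length \<open>n\<close>.\<close>

definition block_start :: "nat \<Rightarrow> nat \<Rightarrow> nat" where
  "block_start n c = (\<Sum>i<c. n + i)"

lemma block_position:
  assumes "n > 0"
  obtains c j where "m = block_start n c + j" "j < n + c"
proof -
  have "\<exists>c j. m = block_start n c + j \<and> j < n + c"
  proof (induction m)
    case 0
    show ?case using assms by (intro exI[of _ 0]) (simp add: block_start_def)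
  next
    case (Suc m)
    then obtain c j where m: "m = block_start n c + j" "j < n + c" by blast
    show ?case
    proof (cases "Suc j < n + c")
      case True
      with m show ?thesis by (intro exI[of _ c] exI[of _ "Suc j"]) simp
    next
      \<comment> \<open>The next block starts here and is nonempty because
        \<open>n > 0\<close>.\<close>
      case False
      with m assms show ?thesis
        by (intro exI[of _ "Suc c"] exI[of _ 0]) (simp add: block_start_def)
    qed
  qed
  with that show thesis by blast
qed

section \<open>Comparison with the profile and assembly of the tail\<close>

lemma profile_prefix_Suc:
  "profile_prefix n (Suc c) = profile_prefix n c @ replicate (n + c) (n + c + 1)"
  by (simp add: profile_prefix_def)

lemma length_profile_prefix: "length (profile_prefix n c) = Suc (block_start n c)"
  by (induction c) (auto simp: profile_prefix_Suc block_start_def, simp add: profile_prefix_def)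

text \<open>Blocks and constant runs are offset by one: the run of value \<open>n + c + 1\<close>
  starts at the second term of block \<open>c\<close> and ends with the first term of block
  \<open>c + 1\<close>, giving \<open>n + c\<close> copies.\<close>

lemma map_eq_profile_prefix:
  assumes f: "\<And>c j. j < n + c \<Longrightarrow> f (block_start n c + j) = n + c + (if j = 0 then 0 else 1)"
    and n: "n > 0"
  shows "map f [0..<length (profile_prefix n c)] = profile_prefix n c"
proof (induction c)
  case 0
  show ?case using f[of 0 0] n by (simp add: profile_prefix_def block_start_def)
next
  case (Suc c)
  define s where "s = block_start n c"
  have s_Suc: "block_start n (Suc c) = s + (n + c)" by (simp add: s_def block_start_def)
  have "f (Suc s + i) = n + c + 1" if "i < n + c" for i
  proof (cases "Suc i < n + c")
    case True
    with f[of "Suc i" c] show ?thesis by (simp add: s_def)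
  next
    case False
    with that have "Suc s + i = block_start n (Suc c)" using s_Suc by simp
    with f[of 0 "Suc c"] show ?thesis by simp
  qed
  then have "map f [Suc s..<Suc s + (n + c)] = replicate (n + c) (n + c + 1)"
    by (intro nth_equalityI) (simp_all del: upt_Suc)
  moreover have "[0..<Suc s + (n + c)] = [0..<Suc s] @ [Suc s..<Suc s + (n + c)]"
    by (rule upt_add_eq_append) simp
  ultimately show ?case
    using Suc unfolding length_profile_prefix s_Suc s_def[symmetric]
    by (simp add: profile_prefix_Suc del: upt_Suc)
qed

text \<open>Inside a block each application moves one letter; the passage from
  \<open>j = length b\<close> to the next block appends a zero.\<close>

lemma TAIL_block:
  fixes \<mu> :: "nat list"
  defines "n \<equiv> Suc (length (Bword \<mu>))"
  assumes "j < n + c"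
  shows "TAIL \<mu> (block_start n c + j) = Some (dyck_class (cyc (Bword \<mu> @ replicate c 0) j))"
  using assms(2)
proof (induction c arbitrary: j)
  case 0
  then show ?case
  proof (induction j)
    case 0
    show ?case by (simp add: block_start_def TAIL_def TI_eq_cyc)
  next
    case (Suc j)
    then show ?case
      using class_NU1_cyc[OF set_Bword, of j \<mu>] by (simp add: TAIL_Suc n_def)
  qed
next
  case (Suc c)
  define b where "b = Bword \<mu> @ replicate c 0"
  have b: "set b \<subseteq> {0, 1}" using set_Bword[of \<mu>] by (auto simp: b_def)
  have b0: "Bword \<mu> @ replicate (Suc c) 0 = b @ [0]" by (simp add: b_def replicate_append_same)
  from Suc.prems show ?case unfolding b0
  proof (induction j)
    case 0
    have "block_start n (Suc c) = Suc (block_start n c + length b)"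
      by (simp add: block_start_def n_def b_def)
    then show ?case
      using class_NU1_cyc_last[OF b] Suc.IH[of "length b"] by (simp add: TAIL_Suc n_def b_def)
  next
    case (Suc j)
    then show ?case
      using class_NU1_cyc[of "b @ [0]" j] b by (simp add: TAIL_Suc n_def b_def)
  qed
qed

theorem theorem2p16:
  fixes \<mu> :: "nat list"
  assumes "int_partition \<mu>"
  shows "\<exists>T :: nat \<Rightarrow> int list set.
    (\<forall>m. TAIL \<mu> m = Some (T m)) \<and>
    range T = {dyck_class z | z c. z \<in> cycled_versions (0 # Bword \<mu> @ replicate c 0)} \<and>
    class_min_delta (TI \<mu>) = part \<mu> 1 + length \<mu> + 1 \<and>
    (\<forall>c. let W = profile_prefix (class_min_delta (TI \<mu>)) c
         in map (\<lambda>m. class_min_delta (T m)) [0..<length W] = W) \<and>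
    (\<forall>m. \<forall>v\<in>T m. defc v = int (sum_list \<mu>))"
proof -
  define n where "n = Suc (length (Bword \<mu>))"
  define b where "b c = Bword \<mu> @ replicate c 0" for c
  define T where "T m = the (TAIL \<mu> m)" for m
  have b_set: "set (b c) \<subseteq> {0, 1}" for c using set_Bword[of \<mu>] by (auto simp: b_def)
  have b_hd: "b c = [] \<or> hd (b c) = 0" for c
    using hd_Bword[of \<mu>] by (cases "Bword \<mu>"; cases c) (auto simp: b_def)
  have n: "n > 0" by (simp add: n_def)
  \<comment> \<open>The offsets \<open>j < n + c\<close> of block \<open>c\<close> are therefore
    exactly the indices of the cycled versions of \<open>0 # b c\<close>.\<close>
  have len: "Suc (length (b c)) = n + c" for c by (simp add: b_def n_def)
  have block: "TAIL \<mu> (block_start n c + j) = Some (dyck_class (cyc (b c) j))" if "j < n + c" for c j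
    using TAIL_block[of j \<mu> c] that by (simp add: n_def b_def)
  then have T_block: "T (block_start n c + j) = dyck_class (cyc (b c) j)" if "j < n + c" for c j
    using that by (simp add: T_def)
  have TAIL: "TAIL \<mu> m = Some (T m)" for m
    using block_position[OF n, of m] block T_block by metis
  have range: "range T = {dyck_class z | z c. z \<in> cycled_versions (0 # Bword \<mu> @ replicate c 0)}"
    (is "_ = ?R")
  proof
    show "range T \<subseteq> ?R"
    proof
      fix C assume "C \<in> range T"
      then obtain m where "C = T m" by blast
      moreover obtain c j where "m = block_start n c + j" "j < n + c"
        using block_position[OF n] .
      ultimately have "C = dyck_class (cyc (b c) j)" "j \<le> length (b c)"
        using T_block len[of c] by auto
      then show "C \<in> ?R" unfolding cycled_versions_eq b_def by blast
    qed
    show "?R \<subseteq> range T"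
    proof
      fix C assume "C \<in> ?R"
      then obtain c j where "C = dyck_class (cyc (b c) j)" "j \<le> length (b c)"
        unfolding cycled_versions_eq b_def by blast
      then have "C = T (block_start n c + j)" using T_block[of j c] len[of c] by simp
      then show "C \<in> range T" by blast
    qed
  qed
  have md: "class_min_delta (T (block_start n c + j)) = n + c + (if j = 0 then 0 else 1)"
    if "j < n + c" for c j
    using class_min_delta_cyc[OF b_set b_hd, of j c] T_block[OF that] that len[of c] by simp
  have TI: "TI \<mu> = T 0" by (simp add: T_def TAIL_def)
  have mdTI: "class_min_delta (TI \<mu>) = n" using md[of 0 0] n by (simp add: TI block_start_def)
  have "\<forall>v\<in>T m. defc v = int (sum_list \<mu>)" for m
    using TAIL_defc[OF TAIL[of m]] defc_dyck_class defc_Bword[OF assms] by metis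
  moreover have "n = part \<mu> 1 + length \<mu> + 1" using length_Bword[OF assms] by (simp add: n_def)
  ultimately show ?thesis
    using TAIL range mdTI map_eq_profile_prefix[of n "\<lambda>m. class_min_delta (T m)", OF md n]
    by (intro exI[of _ T]) (simp add: Let_def)
qed

end
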